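(* Let $G$ be a finite simple connected graph with at least one edge, with maximum degree $\Delta$ and minimum degree $\delta$, and suppose $G\ncong K_2$. Then $$\frac{SDD(\mathcal{L}(G))}{SDD(G)}\leq \frac{\Delta^{2}-\delta}{4\delta}\left(\frac{4(\Delta-1)^{2}+(\max\{2\delta-2,1\})^{2}}{(\Delta-1)\cdot\max\{2\delta-2,1\}}\right),$$ with equality if and only if $G$ is regular.
   Context: For a finite simple graph $H$ with edge set $E_H$, $d_u$ denotes the degree of vertex $u$ in $H$, and the symmetric division deg index is $SDD(H)=\sum_{uv\in E_H}\left(\frac{d_u}{d_v}+\frac{d_v}{d_u}\right)$. The line graph $\mathcal{L}(G)$ has vertex set $E_G$, two vertices being adjacent when the corresponding edges of $G$ share a common endpoint. *)

theory Defs
  imports Complex_Main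
begin

record 'a graph =
  verts :: "'a set"
  edges :: "'a set set"

definition finite_simple_graph :: "'a graph \<Rightarrow> bool" where
  "finite_simple_graph G \<longleftrightarrow> finite (verts G) \<and> (\<forall>e\<in>edges G. e \<subseteq> verts G \<and> card e = 2)"

definition connected_graph :: "'a graph \<Rightarrow> bool" where
  "connected_graph G \<longleftrightarrow> verts G \<noteq> {} \<and>
    (\<forall>u\<in>verts G. \<forall>v\<in>verts G. (u, v) \<in> {(x, y). {x, y} \<in> edges G}\<^sup>*)"

definition graph_isomorphic :: "'a graph \<Rightarrow> 'b graph \<Rightarrow> bool" where
  "graph_isomorphic G H \<longleftrightarrow>
    (\<exists>f. bij_betw f (verts G) (verts H) \<and>
      (\<forall>u\<in>verts G. \<forall>v\<in>verts G. {u, v} \<in> edges G \<longleftrightarrow> {f u, f v} \<in> edges H))"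

definition complete_graph :: "nat \<Rightarrow> nat graph" where
  "complete_graph n = \<lparr>verts = {..<n}, edges = {e. e \<subseteq> {..<n} \<and> card e = 2}\<rparr>"

definition degree :: "'a graph \<Rightarrow> 'a \<Rightarrow> nat" where
  "degree G v = card {e \<in> edges G. v \<in> e}"

definition max_degree :: "'a graph \<Rightarrow> nat" where
  "max_degree G = Max (degree G ` verts G)"

definition min_degree :: "'a graph \<Rightarrow> nat" where
  "min_degree G = Min (degree G ` verts G)"

definition regular_graph :: "'a graph \<Rightarrow> bool" where
  "regular_graph G \<longleftrightarrow> (\<exists>k. \<forall>v\<in>verts G. degree G v = k)"

definition line_graph :: "'a graph \<Rightarrow> 'a set graph" where
  "line_graph G = \<lparr>verts = edges G,
    edges = {{e, f} | e f. e \<in> edges G \<and> f \<in> edges G \<and> e \<noteq> f \<and> e \<inter> f \<noteq> {}}\<rparr>"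

text \<open>The summand of an edge is symmetric in its endpoints, so it depends only on the
  unordered pair; \<open>sdd_edge_insert\<close> below confirms that the description is well defined.\<close>

definition sdd_edge :: "'a graph \<Rightarrow> 'a set \<Rightarrow> real" where
  "sdd_edge G e = (THE x. \<exists>u v. e = {u, v} \<and>
     x = real (degree G u) / real (degree G v) + real (degree G v) / real (degree G u))"

lemma sdd_edge_insert:
  "sdd_edge G {u, v} =
     real (degree G u) / real (degree G v) + real (degree G v) / real (degree G u)"
  unfolding sdd_edge_def by (rule the_equality) (auto simp: doubleton_eq_iff)

definition SDD :: "'a graph \<Rightarrow> real" where
  "SDD G = (\<Sum>e\<in>edges G. sdd_edge G e)"

end

theory Submission
  imports Defs
begin

text \<open>Vertices of \<open>\<L>(G)\<close> have degree \<open>d\<^sub>u + d\<^sub>v - 2\<close>, which lies between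
  \<open>M = max (2\<delta> - 2) 1\<close> and \<open>2\<Delta> - 2\<close>, so every summand of \<open>SDD(\<L>(G))\<close> is at most
  \<open>T = (2\<Delta> - 2)/M + M/(2\<Delta> - 2)\<close>, while every summand of \<open>SDD(G)\<close> is at least 2. With \<open>n\<close>
  vertices and \<open>m\<close> edges, \<open>2|E(\<L>(G))| = (\<Sum>u. d\<^sub>u\<^sup>2) - 2m \<le> n\<Delta>\<^sup>2 - 2m\<close>, and \<open>n\<delta> \<le> 2m\<close>
  by the handshake lemma. Equality forces \<open>(\<Sum>u. d\<^sub>u\<^sup>2) = n\<Delta>\<^sup>2\<close>, that is, regularity.\<close>

section \<open>Edges, degrees and double counting of incidences\<close>

lemma finite_edges: "finite_simple_graph G \<Longrightarrow> finite (edges G)"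
  unfolding finite_simple_graph_def
  by (rule finite_subset[of _ "Pow (verts G)"]) auto

lemma edge_obtain:
  assumes "finite_simple_graph G" "e \<in> edges G"
  obtains u v where "e = {u, v}" "u \<noteq> v" "u \<in> verts G" "v \<in> verts G"
  using assms unfolding finite_simple_graph_def by (metis card_2_iff insert_subset)

lemma degree_pos:
  assumes "finite_simple_graph G" "e \<in> edges G" "v \<in> e"
  shows "degree G v > 0"
  unfolding degree_def using assms finite_edges[OF assms(1)] by (auto simp: card_gt_0_iff)

text \<open>Double counting of incident pairs \<open>(u, e)\<close>. The weight \<open>f\<close> is
  kept general: \<open>f = 1\<close> gives the handshake lemma, \<open>f = degree G\<close> the sum
  of squared degrees.\<close>

lemma sum_edges_sum_ends:
  fixes f :: "'a \<Rightarrow> nat"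
  assumes "finite_simple_graph G"
  shows "(\<Sum>e\<in>edges G. \<Sum>u\<in>e. f u) = (\<Sum>u\<in>verts G. degree G u * f u)"
proof -
  have "(\<Sum>e\<in>edges G. \<Sum>u\<in>e. f u) = (\<Sum>e\<in>edges G. \<Sum>u\<in>{u\<in>verts G. u \<in> e}. f u)"
    using assms by (intro sum.cong) (auto simp: finite_simple_graph_def)
  also have "\<dots> = (\<Sum>u\<in>verts G. \<Sum>e\<in>{e\<in>edges G. u \<in> e}. f u)"
    using assms finite_edges[OF assms]
    by (intro sum.swap_restrict) (auto simp: finite_simple_graph_def)
  finally show ?thesis by (simp add: degree_def)
qed

lemma handshake:
  assumes "finite_simple_graph G"
  shows "(\<Sum>v\<in>verts G. degree G v) = 2 * card (edges G)"
proof -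
  have "(\<Sum>e\<in>edges G. \<Sum>u\<in>e. 1) = (\<Sum>e\<in>edges G. (2::nat))"
    using assms by (intro sum.cong) (auto simp: finite_simple_graph_def)
  then show ?thesis using sum_edges_sum_ends[OF assms, of "\<lambda>_. 1"] by simp
qed

section \<open>Degrees and number of edges of the line graph\<close>

lemma verts_line_graph: "verts (line_graph G) = edges G"
  by (simp add: line_graph_def)

lemma finite_simple_line_graph:
  assumes "finite_simple_graph G"
  shows "finite_simple_graph (line_graph G)"
  using finite_edges[OF assms]
  by (auto simp: finite_simple_graph_def line_graph_def card_2_iff)

text \<open>The neighbours of \<open>e = {u, v}\<close> are the other edges at \<open>u\<close> and
  the other edges at \<open>v\<close>; these groups are disjoint, since two vertices determine an
  edge. Dropping \<open>e\<close> from both groups accounts for the 2, which is added on the left to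
  avoid truncated subtraction.\<close>

lemma degree_line_graph:
  assumes G: "finite_simple_graph G" and e: "e \<in> edges G"
  shows "degree (line_graph G) e + 2 = (\<Sum>u\<in>e. degree G u)"
proof -
  obtain u v where uv: "e = {u, v}" "u \<noteq> v" using edge_obtain[OF G e] by metis
  let ?N = "\<lambda>w. {f \<in> edges G. w \<in> f} - {e}"
  note fin = finite_edges[OF G]
  have "{p \<in> edges (line_graph G). e \<in> p} = (\<lambda>f. {e, f}) ` (?N u \<union> ?N v)"
  proof (intro set_eqI iffI)
    fix p assume "p \<in> {p \<in> edges (line_graph G). e \<in> p}"
    then obtain f g where fg: "f \<in> edges G" "g \<in> edges G" "f \<noteq> g" "f \<inter> g \<noteq> {}"
      "p = {f, g}" "e = f \<or> e = g"
      by (auto simp: line_graph_def)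
    then obtain h where "h \<in> edges G" "h \<noteq> e" "e \<inter> h \<noteq> {}" "p = {e, h}"
      by (metis insert_commute Int_commute)
    then show "p \<in> (\<lambda>f. {e, f}) ` (?N u \<union> ?N v)" using uv by (intro image_eqI[of _ _ h]) auto
  next
    fix p assume "p \<in> (\<lambda>f. {e, f}) ` (?N u \<union> ?N v)"
    then obtain h where "h \<in> edges G" "h \<noteq> e" "e \<inter> h \<noteq> {}" "p = {e, h}" using uv by auto
    then show "p \<in> {p \<in> edges (line_graph G). e \<in> p}"
      using e unfolding line_graph_def by auto
  qed
  moreover have "inj_on (\<lambda>f. {e, f}) (?N u \<union> ?N v)"
    by (auto simp: inj_on_def doubleton_eq_iff)
  ultimately have "degree (line_graph G) e = card (?N u \<union> ?N v)"
    by (simp add: degree_def card_image)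
  also have "\<dots> = card (?N u) + card (?N v)"
  proof (rule card_Un_disjoint)
    show "?N u \<inter> ?N v = {}"
    proof (rule ccontr)
      assume "?N u \<inter> ?N v \<noteq> {}"
      then obtain f where f: "f \<in> edges G" "u \<in> f" "v \<in> f" "f \<noteq> e" by blast
      then show False using edge_obtain[OF G f(1)] uv by (metis doubleton_eq_iff insertE singletonD)
    qed
  qed (use fin in auto)
  also have "\<dots> + 2 = degree G u + degree G v"
  proof -
    have "card (?N w) + 1 = degree G w" if "w \<in> e" for w
      using that e fin degree_pos[OF G e that] by (simp add: degree_def card_Diff_singleton)
    from this[of u] this[of v] show ?thesis using uv by auto
  qed
  finally show ?thesis using uv by simp
qed

text \<open>By the handshake lemma in \<open>line_graph G\<close>, the left side is the sum of
  \<open>d_u + d_v\<close> over the edges \<open>{u, v}\<close> of \<open>G\<close>, in which each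
  \<open>d_u\<close> occurs \<open>d_u\<close> times.\<close>

lemma card_edges_line_graph:
  assumes G: "finite_simple_graph G"
  shows "2 * card (edges (line_graph G)) + 2 * card (edges G) = (\<Sum>u\<in>verts G. (degree G u)\<^sup>2)"
proof -
  have "2 * card (edges (line_graph G)) + 2 * card (edges G)
      = (\<Sum>e\<in>edges G. degree (line_graph G) e + 2)"
    using handshake[OF finite_simple_line_graph[OF G]]
    by (simp add: sum.distrib verts_line_graph del: add_2_eq_Suc')
  also have "\<dots> = (\<Sum>e\<in>edges G. \<Sum>u\<in>e. degree G u)"
    using degree_line_graph[OF G] by (intro sum.cong) auto
  finally show ?thesis using sum_edges_sum_ends[OF G] by (simp add: power2_eq_square)
qed

section \<open>Degree bounds and consequences of connectedness\<close>

lemma degree_bounds: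
  assumes "finite_simple_graph G" "v \<in> verts G"
  shows "min_degree G \<le> degree G v" "degree G v \<le> max_degree G"
  using assms by (auto simp: finite_simple_graph_def min_degree_def max_degree_def)

lemma regular_graph_degree_eq:
  assumes "regular_graph G" "v \<in> verts G"
  shows "degree G v = max_degree G" "degree G v = min_degree G"
proof -
  obtain k where "\<forall>v\<in>verts G. degree G v = k" using assms(1) by (auto simp: regular_graph_def)
  then have "degree G ` verts G = {degree G v}" using assms(2) by auto
  then show "degree G v = max_degree G" "degree G v = min_degree G"
    by (simp_all add: max_degree_def min_degree_def)
qed

text \<open>An edge supplies a vertex \<open>w\<close> other than \<open>v\<close>, and the first
  step of a walk from \<open>v\<close> to \<open>w\<close> is an edge at \<open>v\<close>.\<close>

lemma connected_degree_pos:
  assumes G: "finite_simple_graph G" "connected_graph G" "edges G \<noteq> {}" and v: "v \<in> verts G"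
  shows "degree G v > 0"
proof -
  obtain e where e: "e \<in> edges G" using G(3) by blast
  obtain a b where ab: "e = {a, b}" "a \<noteq> b" "a \<in> verts G" "b \<in> verts G"
    using edge_obtain[OF G(1) e] .
  then obtain w where w: "w \<in> verts G" "w \<noteq> v" by metis
  have "(v, w) \<in> {(x, y). {x, y} \<in> edges G}\<^sup>*"
    using G(2) v w by (auto simp: connected_graph_def)
  then obtain z where "{v, z} \<in> edges G" using w(2) by (auto elim: converse_rtranclE)
  then show ?thesis using degree_pos[OF G(1)] by blast
qed

text \<open>Neither endpoint has an edge besides \<open>{u, v}\<close>, so a walk from
  \<open>u\<close> never leaves \<open>{u, v}\<close>; connectedness then excludes further
  vertices.\<close>

lemma isolated_edge_imp_K2:
  assumes G: "finite_simple_graph G" "connected_graph G" and e: "{u, v} \<in> edges G"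
    and deg: "degree G u = 1" "degree G v = 1"
  shows "graph_isomorphic G (complete_graph 2)"
proof -
  have uv: "u \<noteq> v" "u \<in> verts G" "v \<in> verts G"
    using edge_obtain[OF G(1) e] by (metis doubleton_eq_iff)+
  have only: "f = {u, v}" if "f \<in> edges G" "w \<in> f" "w \<in> {u, v}" for f w
  proof -
    have "card {f \<in> edges G. w \<in> f} = 1" using that(3) deg by (auto simp: degree_def)
    then obtain g where "{f \<in> edges G. w \<in> f} = {g}" by (auto simp: card_1_singleton_iff)
    then show ?thesis using that e by (metis (mono_tags, lifting) mem_Collect_eq singletonD)
  qed
  have V: "verts G = {u, v}"
  proof
    show "verts G \<subseteq> {u, v}"
    proof
      fix x assume "x \<in> verts G"
      then have "(u, x) \<in> {(x, y). {x, y} \<in> edges G}\<^sup>*"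
        using G(2) uv by (auto simp: connected_graph_def)
      then show "x \<in> {u, v}"
      proof (induction rule: rtrancl_induct)
        case (step y z)
        then have "{y, z} = {u, v}" using only[of "{y, z}" y] by auto
        then show ?case by auto
      qed simp
    qed
  qed (use uv in auto)
  \<comment> \<open>Settles the case \<open>x = y\<close> of the isomorphism condition, where
    \<open>{x, y}\<close> collapses to a singleton.\<close>
  have single: "{x} \<notin> edges G" for x
    using G(1) by (auto simp: finite_simple_graph_def)
  let ?f = "\<lambda>x. if x = u then 0 else 1 :: nat"
  have "bij_betw ?f (verts G) (verts (complete_graph 2))"
    using V uv by (auto simp: bij_betw_def inj_on_def complete_graph_def)
  moreover have "\<forall>x\<in>verts G. \<forall>y\<in>verts G.
      {x, y} \<in> edges G \<longleftrightarrow> {?f x, ?f y} \<in> edges (complete_graph 2)"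
    using V uv e single by (auto simp: complete_graph_def insert_commute)
  ultimately show ?thesis unfolding graph_isomorphic_def by blast
qed

text \<open>Source of the 1 in \<open>max (2 * \<delta> - 2) 1\<close>: it keeps the lower bound on
  line graph degrees positive when \<open>\<delta> = 1\<close>.\<close>

lemma degree_line_graph_pos:
  assumes G: "finite_simple_graph G" "connected_graph G"
    and nK2: "\<not> graph_isomorphic G (complete_graph 2)" and e: "e \<in> edges G"
  shows "degree (line_graph G) e \<ge> 1"
proof -
  obtain u v where uv: "e = {u, v}" "u \<noteq> v" using edge_obtain[OF G(1) e] by metis
  have "degree G u > 0" "degree G v > 0" using degree_pos[OF G(1) e] uv by auto
  moreover have "\<not> (degree G u = 1 \<and> degree G v = 1)"
    using isolated_edge_imp_K2[OF G] nK2 e uv by metis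
  ultimately show ?thesis using degree_line_graph[OF G(1) e] uv by auto
qed

section \<open>Bounds on the summands and on \<open>SDD\<close>\<close>

lemma add_divide_swap_ge_2:
  fixes a b :: real
  assumes "a > 0" "b > 0"
  shows "a / b + b / a \<ge> 2"
proof -
  have "a / b + b / a - 2 = (a - b)\<^sup>2 / (a * b)"
    using assms by (simp add: field_simps power2_eq_square)
  also have "\<dots> \<ge> 0" using assms by simp
  finally show ?thesis by simp
qed

text \<open>Over the common denominator \<open>L * U * a * b\<close>, the difference of the two
  sides has numerator \<open>(U * b - L * a) * (U * a - L * b)\<close>, a product of nonnegative
  factors.\<close>

lemma add_divide_swap_le:
  fixes a b L U :: real
  assumes "0 < L" "L \<le> a" "a \<le> U" "L \<le> b" "b \<le> U"
  shows "a / b + b / a \<le> U / L + L / U"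
proof -
  have pos: "a > 0" "b > 0" "U > 0" using assms by auto
  have "a * L \<le> b * U" "b * L \<le> a * U"
    using assms pos by (metis less_imp_le mult.commute mult_mono order_trans)+
  then have "(U / L + L / U) - (a / b + b / a) = (U * b - L * a) * (U * a - L * b) / (L * U * a * b)"
    using assms pos by (simp add: field_simps power2_eq_square)
  also have "\<dots> \<ge> 0"
    using \<open>a * L \<le> b * U\<close> \<open>b * L \<le> a * U\<close> assms pos
    by (intro divide_nonneg_nonneg mult_nonneg_nonneg) (auto simp: mult.commute)
  finally show ?thesis by simp
qed

lemma SDD_ge:
  assumes G: "finite_simple_graph G"
  shows "SDD G \<ge> 2 * real (card (edges G))"
proof -
  have "sdd_edge G e \<ge> 2" if e: "e \<in> edges G" for e
  proof -
    obtain u v where "e = {u, v}" using edge_obtain[OF G e] by metis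
    then show ?thesis
      using degree_pos[OF G e] add_divide_swap_ge_2 by (simp add: sdd_edge_insert)
  qed
  then have "(\<Sum>e\<in>edges G. 2) \<le> SDD G" unfolding SDD_def by (intro sum_mono)
  then show ?thesis by simp
qed

lemma SDD_le:
  assumes G: "finite_simple_graph G" and "0 < L"
    and "\<And>v. v \<in> verts G \<Longrightarrow> L \<le> real (degree G v) \<and> real (degree G v) \<le> U"
  shows "SDD G \<le> (U / L + L / U) * real (card (edges G))"
proof -
  have "sdd_edge G e \<le> U / L + L / U" if e: "e \<in> edges G" for e
  proof -
    obtain u v where "e = {u, v}" "u \<in> verts G" "v \<in> verts G" using edge_obtain[OF G e] by metis
    then show ?thesis using assms add_divide_swap_le by (simp add: sdd_edge_insert)
  qed
  then have "SDD G \<le> (\<Sum>e\<in>edges G. U / L + L / U)" unfolding SDD_def by (intro sum_mono)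
  then show ?thesis by (simp add: mult.commute)
qed

text \<open>With \<open>L = U = k\<close> the upper bound \<open>SDD_le\<close> is 2 per edge and
  meets the lower bound \<open>SDD_ge\<close>.\<close>

lemma SDD_regular:
  assumes G: "finite_simple_graph G"
    and k: "\<And>v. v \<in> verts G \<Longrightarrow> degree G v = k" and "k > 0"
  shows "SDD G = 2 * real (card (edges G))"
  using SDD_le[OF G, of "real k" "real k"] SDD_ge[OF G] assms by simp

section \<open>The ratio of the two indices and its equality case\<close>

theorem theorem4p8:
  fixes G :: "'a graph" and \<Delta> \<delta> :: real
  assumes "finite_simple_graph G"
    and "connected_graph G"
    and "edges G \<noteq> {}"
    and "\<not> graph_isomorphic G (complete_graph 2)"
    and "\<Delta> = real (max_degree G)"
    and "\<delta> = real (min_degree G)"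
  shows "let B = (\<Delta>\<^sup>2 - \<delta>) / (4 * \<delta>) *
                 ((4 * (\<Delta> - 1)\<^sup>2 + (max (2 * \<delta> - 2) 1)\<^sup>2) / ((\<Delta> - 1) * max (2 * \<delta> - 2) 1))
         in SDD (line_graph G) / SDD G \<le> B \<and>
            (SDD (line_graph G) / SDD G = B \<longleftrightarrow> regular_graph G)"
proof -
  note G = assms(1)
  define M where "M = max (2 * \<delta> - 2) 1"
  define U where "U = 2 * \<Delta> - 2"
  define T where "T = U / M + M / U"
  define B where "B = (\<Delta>\<^sup>2 - \<delta>) / (4 * \<delta>) *
                 ((4 * (\<Delta> - 1)\<^sup>2 + M\<^sup>2) / ((\<Delta> - 1) * M))"
  define m where "m = real (card (edges G))"
  define l where "l = real (card (edges (line_graph G)))"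
  define n where "n = real (card (verts G))"
  define q where "q = (\<Sum>v\<in>verts G. (real (degree G v))\<^sup>2)"
  have finV: "finite (verts G)" and neV: "verts G \<noteq> {}"
    using assms by (auto simp: finite_simple_graph_def connected_graph_def)
  have m: "m > 0" using assms finite_edges[OF G] by (simp add: m_def card_gt_0_iff)
  have dle: "real (degree G v) \<le> \<Delta>" and dge: "\<delta> \<le> real (degree G v)" if "v \<in> verts G" for v
    using degree_bounds[OF G that] assms by auto
  have "min_degree G \<in> degree G ` verts G"
    unfolding min_degree_def using finV neV by (intro Min_in) auto
  then have d1: "\<delta> \<ge> 1" using connected_degree_pos[OF G assms(2,3)] assms(6) by fastforce
  have line_deg: "M \<le> real (degree (line_graph G) e) \<and> real (degree (line_graph G) e) \<le> U"
    if e: "e \<in> edges G" for e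
  proof -
    obtain u v where uv: "e = {u, v}" "u \<noteq> v" "u \<in> verts G" "v \<in> verts G"
      using edge_obtain[OF G e] .
    have "real (degree (line_graph G) e) + 2 = real (degree G u) + real (degree G v)"
      using degree_line_graph[OF G e] uv by simp
    then show ?thesis
      using degree_line_graph_pos[OF G assms(2,4) e] dle[OF uv(3)] dle[OF uv(4)]
        dge[OF uv(3)] dge[OF uv(4)] by (auto simp: M_def U_def)
  qed
  have M: "M \<ge> 1" by (simp add: M_def)
  \<comment> \<open>Any edge witnesses \<open>1 \<le> M \<le> U\<close>; hence
    \<open>\<Delta> > 1\<close>, and \<open>U\<close> and \<open>\<Delta> - 1\<close> are nonzero
    denominators.\<close>
  obtain e where "e \<in> edges G" using assms(3) by blast
  then have U: "U > 0" using line_deg[of e] M by linarith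
  have T: "T > 0" using M U by (simp add: T_def add_pos_pos)
  have SL: "SDD (line_graph G) \<le> T * l"
    unfolding T_def l_def using finite_simple_line_graph[OF G] line_deg M
    by (intro SDD_le) (auto simp: verts_line_graph)
  have lm: "2 * l + 2 * m = q"
    using arg_cong[OF card_edges_line_graph[OF G], of real] by (simp add: l_def m_def q_def)
  have qn: "q \<le> n * \<Delta>\<^sup>2"
  proof -
    have "q \<le> (\<Sum>v\<in>verts G. \<Delta>\<^sup>2)"
      unfolding q_def using dle by (intro sum_mono power_mono) auto
    then show ?thesis by (simp add: n_def)
  qed
  have nm: "n * \<delta> \<le> 2 * m"
  proof -
    have "(\<Sum>v\<in>verts G. \<delta>) \<le> (\<Sum>v\<in>verts G. real (degree G v))"
      using dge by (intro sum_mono)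
    also have "\<dots> = 2 * m" using arg_cong[OF handshake[OF G], of real] by (simp add: m_def)
    finally show ?thesis by (simp add: n_def)
  qed
  have B: "B = T * ((\<Delta>\<^sup>2 - \<delta>) / (2 * \<delta>))"
  proof -
    \<comment> \<open>Since \<open>4 * (U / 2)\<^sup>2 = U\<^sup>2\<close>, the second factor of
      \<open>B\<close> becomes \<open>(U\<^sup>2 + M\<^sup>2) / (U * M / 2)\<close>, which is twice
      \<open>T\<close>.\<close>
    have D: "\<Delta> - 1 = U / 2" by (simp add: U_def)
    have "(4 * (U / 2)\<^sup>2 + M\<^sup>2) / (U / 2 * M) = 2 * T"
      unfolding T_def using U M by (simp add: field_simps power2_eq_square)
    then show ?thesis unfolding B_def D by (simp add: mult.commute)
  qed
  have nD: "(n * \<Delta>\<^sup>2 - 2 * m) / (4 * m) \<le> (\<Delta>\<^sup>2 - \<delta>) / (2 * \<delta>)"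
  proof -
    \<comment> \<open>Clearing denominators in the goal cancels the terms in
      \<open>m * \<delta>\<close> and leaves this inequality up to a factor 2.\<close>
    have "(n * \<delta>) * \<Delta>\<^sup>2 \<le> (2 * m) * \<Delta>\<^sup>2" using nm by (intro mult_right_mono) auto
    then show ?thesis using m d1 by (simp add: field_simps)
  qed
  have ratio: "SDD (line_graph G) / SDD G \<le> T * ((q - 2 * m) / (4 * m))"
  proof -
    have "l \<ge> 0" by (simp add: l_def)
    then have "SDD (line_graph G) / SDD G \<le> (T * l) / (2 * m)"
      using SL SDD_ge[OF G] m T by (intro frac_le) (auto simp: m_def)
    also have "\<dots> = T * ((q - 2 * m) / (4 * m))" using m by (simp flip: lm)
    finally show ?thesis .
  qed
  have mid: "T * ((q - 2 * m) / (4 * m)) \<le> T * ((n * \<Delta>\<^sup>2 - 2 * m) / (4 * m))"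
    using qn m T by (intro mult_left_mono divide_right_mono) auto
  have last: "T * ((n * \<Delta>\<^sup>2 - 2 * m) / (4 * m)) \<le> B"
    unfolding B using nD T by (intro mult_left_mono) auto
  have "regular_graph G" if eq: "SDD (line_graph G) / SDD G = B"
  proof -
    \<comment> \<open>A ratio equal to \<open>B\<close> turns every link of the chain
      \<open>ratio\<close>, \<open>mid\<close>, \<open>last\<close> into an equality; the middle
      link determines \<open>q\<close>.\<close>
    have "T * ((q - 2 * m) / (4 * m)) = T * ((n * \<Delta>\<^sup>2 - 2 * m) / (4 * m))"
      using eq ratio mid last by linarith
    then have "q = n * \<Delta>\<^sup>2" using T m by simp
    then have "(\<Sum>v\<in>verts G. \<Delta>\<^sup>2 - (real (degree G v))\<^sup>2) = 0"
      by (simp add: sum_subtractf q_def n_def)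
    moreover have "\<Delta>\<^sup>2 - (real (degree G v))\<^sup>2 \<ge> 0" if "v \<in> verts G" for v
      using dle[OF that] by (simp add: power_mono)
    ultimately have "\<forall>v\<in>verts G. \<Delta>\<^sup>2 - (real (degree G v))\<^sup>2 = 0"
      using finV by (simp add: sum_nonneg_eq_0_iff)
    then have "\<forall>v\<in>verts G. degree G v = max_degree G" using assms(5) by auto
    then show ?thesis by (auto simp: regular_graph_def)
  qed
  moreover have "SDD (line_graph G) / SDD G = B" if reg: "regular_graph G"
  proof -
    have d: "real (degree G v) = \<Delta>" "\<delta> = \<Delta>" if "v \<in> verts G" for v
      using regular_graph_degree_eq[OF reg that] assms by auto
    have dD: "\<delta> = \<Delta>" using d neV by blast
    \<comment> \<open>\<open>\<Delta>\<close> is an integer greater than 1. Then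
      \<open>2 * \<Delta> - 2\<close> exceeds 1, so the maximum defining \<open>M\<close> is its
      first argument.\<close>
    have D2: "\<Delta> \<ge> 2"
      using U assms(5) by (simp add: U_def)
    then have MU: "M = U" using dD by (simp add: M_def U_def)
    \<comment> \<open>\<open>M = U\<close> squeezes all line graph degrees to one value, so
      \<open>line_graph G\<close> is regular too.\<close>
    have deg: "degree (line_graph G) f = degree (line_graph G) e"
      if "f \<in> edges G" for f
      using line_deg[OF that] line_deg[OF \<open>e \<in> edges G\<close>] MU by simp
    have "SDD (line_graph G) = 2 * l"
      unfolding l_def using deg degree_line_graph_pos[OF G assms(2,4) \<open>e \<in> edges G\<close>]
      by (intro SDD_regular[where k = "degree (line_graph G) e"] finite_simple_line_graph[OF G])
        (auto simp: verts_line_graph)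
    moreover have "SDD G = 2 * m"
      unfolding m_def using regular_graph_degree_eq(1)[OF reg] D2 assms(5)
      by (intro SDD_regular[where k = "max_degree G"] G) auto
    moreover have "n * \<Delta> = 2 * m"
      using arg_cong[OF handshake[OF G], of real] d by (simp add: m_def n_def)
    moreover have "q = n * \<Delta>\<^sup>2" using d by (simp add: q_def n_def)
    \<comment> \<open>Here \<open>2 * l = n * \<Delta>\<^sup>2 - 2 * m = 2 * m * (\<Delta> -
      1)\<close>.\<close>
    ultimately have "SDD (line_graph G) / SDD G = l / m" "l = m * (\<Delta> - 1)"
      using lm by (auto simp: power2_eq_square algebra_simps)
    \<comment> \<open>\<open>M = U\<close> gives \<open>T = 2\<close>, and
      \<open>\<delta> = \<Delta>\<close> reduces \<open>B\<close> to
      \<open>(\<Delta>\<^sup>2 - \<Delta>) / \<Delta>\<close>.\<close>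
    moreover have "B = \<Delta> - 1"
      unfolding B T_def using MU U dD D2 by (simp add: field_simps power2_eq_square)
    ultimately show ?thesis using m by simp
  qed
  ultimately show ?thesis
    using ratio mid last unfolding B_def M_def Let_def by (meson order_trans)
qed

end
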